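(* Let $U$ and $X$ be finite-dimensional inner product spaces, let $A\in\mathcal{L}(X)$ and $B\in\mathcal{L}(U,X)$ be linear maps, and let $f\colon X\to X$ be given by $f(x)=\Gamma(x,x)$ for a symmetric bilinear map $\Gamma\colon X\times X\to X$. Assume that for each $\gamma\in X$ there exist $u,\xi\in U$ such that $\gamma=Bu-f(B\xi)$. Then for every $\tau>0$ the control system $$\dot{x}(t)+Ax(t)+f(x(t))=Bu(t)\quad (t\in[0,\tau]),\qquad x(0)=x_0,$$ is weakly approximately tracking controllable on $[0,\tau]$. More precisely, given any $\psi\in W^{1,2}((0,\tau);X)$ and $\varepsilon>0$, there exists a control $u\in C^\infty([0,\tau];U)$ such that the corresponding solution $x$ of the system with $x_0=\psi(0)$ (exists on $[0,\tau]$ and) satisfies $$|x(\tau)-\psi(\tau)|+|||x-\psi|||_\tau<\varepsilon .$$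
   Context: $|\cdot|$ denotes the norm of $X$. For $\tau>0$ and $v\in L^1([0,\tau];X)$, the relaxation norm is $$|||v|||_\tau:=\sup_{t\in[0,\tau]}\left\|\int_0^t v(s)\,\mathrm{d}s\right\|_X .$$ The system is called weakly approximately tracking controllable on $[0,\tau]$ if for every $\psi\in W^{1,2}((0,\tau);X)$ and every $\varepsilon>0$ there exists $u\in L^2([0,\tau];U)$ such that the solution $x$ of the system with $x(0)=\psi(0)$ satisfies $|||x-\psi|||_\tau\leq\varepsilon$. No assumption excludes finite-time blowup of the uncontrolled dynamics; that the controlled solution is defined on all of $[0,\tau]$ is part of the assertion. *)

theory Defs
  imports "HOL-Analysis.Analysis"
begin

text \<open>At points of \<open>S\<close> that are not interior, such as the endpoints of a compact interval,
  derivatives are taken within \<open>S\<close>, i.e. one-sidedly.\<close>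

definition smooth_on :: "real set \<Rightarrow> (real \<Rightarrow> 'a::real_normed_vector) \<Rightarrow> bool" where
  "smooth_on S u \<longleftrightarrow>
     (\<exists>D :: nat \<Rightarrow> real \<Rightarrow> 'a. (\<forall>t\<in>S. D 0 t = u t) \<and>
        (\<forall>n. \<forall>t\<in>S. (D n has_vector_derivative D (Suc n) t) (at t within S)))"

definition L2_on :: "real \<Rightarrow> (real \<Rightarrow> 'a::euclidean_space) \<Rightarrow> bool" where
  "L2_on \<tau> v \<longleftrightarrow>
     v \<in> borel_measurable (lebesgue_on {0..\<tau>}) \<and>
     integrable (lebesgue_on {0..\<tau>}) (\<lambda>s. (norm (v s))\<^sup>2)"

definition test_function :: "real \<Rightarrow> (real \<Rightarrow> real) \<Rightarrow> bool" where
  "test_function \<tau> \<phi> \<longleftrightarrow>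
     smooth_on UNIV \<phi> \<and>
     compact (closure {s. \<phi> s \<noteq> 0}) \<and> closure {s. \<phi> s \<noteq> 0} \<subseteq> {0<..<\<tau>}"

definition weak_derivative :: "real \<Rightarrow> (real \<Rightarrow> 'a::euclidean_space) \<Rightarrow> (real \<Rightarrow> 'a) \<Rightarrow> bool" where
  "weak_derivative \<tau> v g \<longleftrightarrow>
     (\<forall>\<phi>. test_function \<tau> \<phi> \<longrightarrow>
        integral {0..\<tau>} (\<lambda>s. deriv \<phi> s *\<^sub>R v s) = - integral {0..\<tau>} (\<lambda>s. \<phi> s *\<^sub>R g s))"

text \<open>\<open>W\<^sup>1\<^sup>,\<^sup>2((0,\<tau>);X)\<close>. A Sobolev class in one dimension has a unique continuous
  representative on \<open>[0,\<tau>]\<close>; it is this representative that the point values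
  \<open>\<psi>(0)\<close> and \<open>\<psi>(\<tau>)\<close> refer to, so continuity is part of the predicate.\<close>

definition W12 :: "real \<Rightarrow> (real \<Rightarrow> 'a::euclidean_space) \<Rightarrow> bool" where
  "W12 \<tau> \<psi> \<longleftrightarrow>
     continuous_on {0..\<tau>} \<psi> \<and> L2_on \<tau> \<psi> \<and> (\<exists>g. L2_on \<tau> g \<and> weak_derivative \<tau> \<psi> g)"

text \<open>For \<open>v \<in> L\<^sup>1\<close> the gauge integral below is the Lebesgue integral and the supremum is
  over a bounded set.\<close>

definition relax_norm :: "real \<Rightarrow> (real \<Rightarrow> 'a::euclidean_space) \<Rightarrow> real" where
  "relax_norm \<tau> v = (SUP t\<in>{0..\<tau>}. norm (integral {0..t} v))"

text \<open>Solutions of \<open>x' + A x + f(x) = B u\<close>, \<open>x(0) = x\<^sub>0\<close> on the whole of \<open>[0,\<tau>]\<close>. As controls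
  are in general only square integrable, the equation is understood in integrated form
  (Caratheodory solutions); for continuous \<open>u\<close> these are the classical solutions.
  The case \<open>t = 0\<close> is the initial condition.\<close>

definition is_solution ::
  "('x::euclidean_space \<Rightarrow> 'x) \<Rightarrow> ('u::euclidean_space \<Rightarrow> 'x) \<Rightarrow> ('x \<Rightarrow> 'x) \<Rightarrow> real \<Rightarrow>
    (real \<Rightarrow> 'u) \<Rightarrow> 'x \<Rightarrow> (real \<Rightarrow> 'x) \<Rightarrow> bool" where
  "is_solution A B f \<tau> u x0 x \<longleftrightarrow>
     continuous_on {0..\<tau>} x \<and>
     (\<forall>t\<in>{0..\<tau>}. ((\<lambda>s. B (u s) - A (x s) - f (x s)) has_integral x t - x0) {0..t})"

definition weakly_approx_tracking_controllable ::
  "('x::euclidean_space \<Rightarrow> 'x) \<Rightarrow> ('u::euclidean_space \<Rightarrow> 'x) \<Rightarrow> ('x \<Rightarrow> 'x) \<Rightarrow> real \<Rightarrow> bool" where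
  "weakly_approx_tracking_controllable A B f \<tau> \<longleftrightarrow>
     (\<forall>\<psi> \<epsilon>. W12 \<tau> \<psi> \<longrightarrow> \<epsilon> > 0 \<longrightarrow>
        (\<exists>u x. L2_on \<tau> u \<and> is_solution A B f \<tau> u (\<psi> 0) x \<and>
               relax_norm \<tau> (\<lambda>t. x t - \<psi> t) \<le> \<epsilon>))"

end

theory Submission
  imports Defs
begin

text \<open>
  The drift \<open>f\<close> is quadratic, so a fast oscillation of the state has a mean effect on the slow
  motion although its own mean vanishes: if \<open>v = \<surd>2 sin(\<omega> t) \<xi>\<close> and \<open>\<omega>\<close> is large, then
  \<open>f (B v) = 2 sin\<^sup>2(\<omega> t) f (B \<xi>)\<close> acts like the constant force \<open>f (B \<xi>)\<close>, while everything
  linear in \<open>v\<close> averages out. The oscillation \<open>B v\<close> is produced by the control \<open>v'\<close>. In this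
  way every direction \<open>\<gamma> = B u - f (B \<xi>)\<close> can be generated, also those outside the range of
  \<open>B\<close>; a bilinear \<open>\<Gamma>\<close> scales by the square of the amplitude, hence so do all
  nonnegative multiples \<open>a\<^sup>2 \<gamma>\<close>.

  Replace \<open>\<psi>\<close> by a polynomial \<open>p\<close> that is uniformly close to it. The force
  \<open>\<eta> = p' + A p + f(p)\<close> that would drive the system along \<open>p\<close> is again a polynomial, and
  \<open>e = ((e + 1)/2)\<^sup>2 - ((e - 1)/2)\<^sup>2\<close>, applied to its coordinates, writes it exactly as
  \<open>\<Sum>j. a\<^sub>j\<^sup>2 \<gamma>\<^sub>j\<close> with polynomial amplitudes \<open>a\<^sub>j\<close> and constant directions
  (\<open>polynomial_eq_sum_squares\<close>). So \<open>u\<close> and \<open>\<xi>\<close> are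
  selected for finitely many fixed vectors only, not along \<open>\<eta>(t)\<close>, and the controls are smooth. With
  \<open>\<gamma>\<^sub>j = B u\<^sub>j - f (B \<xi>\<^sub>j)\<close> the amplitude \<open>\<surd>2 a\<^sub>j\<close> is put on \<open>\<xi>\<^sub>j\<close> at its own frequency,
  so that the interaction of two different waves also averages out
  (\<open>weakly_null_bilinear_oscillation\<close>). All frequencies are multiples of \<open>\<pi>/\<tau>\<close>; the
  waves therefore vanish at both ends of the time interval and do not disturb the values there.

  The curve \<open>q = p + B v\<close> thus solves the controlled equation up to a residual whose primitives
  tend to 0 uniformly as the frequencies grow. Since \<open>q\<close> stays bounded independently of the
  frequencies, Picard iteration in an exponentially weighted norm produces a true solution on all of \<open>[0,\<tau>]\<close>
  close to \<open>q\<close> (\<open>solution_near_approximate_solution\<close>). It is close to \<open>\<psi>\<close> at time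
  \<open>\<tau>\<close>, where \<open>B v\<close> vanishes, and in the relaxation norm, which does not see fast oscillations.
\<close>

section \<open>Solutions near approximate solutions\<close>

text \<open>Only primitives of the residual are small, so it enters as an additive term \<open>G\<close> of the
  integral equation rather than as a term of the right-hand side. A quadratic \<open>F\<close> is Lipschitz only
  on bounded sets, here the unit ball: Picard iterates starting at 0 stay below
  \<open>2 \<delta> e\<^sup>2\<^sup>M\<^sup>t\<close>, which the smallness of \<open>\<delta>\<close> keeps inside that ball up to
  time \<open>\<tau>\<close>. So the solution cannot blow up before \<open>\<tau>\<close>.\<close>

lemma small_forcing_integral_equation:
  fixes F :: "real \<Rightarrow> 'x::banach \<Rightarrow> 'x" and G :: "real \<Rightarrow> 'x"
  assumes M: "M > 0"
    and zero: "\<And>s. s \<in> {0..\<tau>} \<Longrightarrow> F s 0 = 0"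
    and lip: "\<And>s y z. s \<in> {0..\<tau>} \<Longrightarrow> norm y \<le> 1 \<Longrightarrow> norm z \<le> 1 \<Longrightarrow>
                norm (F s y - F s z) \<le> M * norm (y - z)"
    and cont_F: "\<And>z. continuous_on {0..\<tau>} z \<Longrightarrow> continuous_on {0..\<tau>} (\<lambda>s. F s (z s))"
    and cont_G: "continuous_on {0..\<tau>} G"
    and G: "\<And>t. t \<in> {0..\<tau>} \<Longrightarrow> norm (G t) \<le> \<delta>"
    and \<delta>: "\<delta> \<ge> 0" "2 * \<delta> * exp (2 * M * \<tau>) \<le> 1"
  obtains z where "continuous_on {0..\<tau>} z"
    and "\<And>t. t \<in> {0..\<tau>} \<Longrightarrow> norm (z t) \<le> 2 * \<delta> * exp (2 * M * \<tau>)"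
    and "\<And>t. t \<in> {0..\<tau>} \<Longrightarrow> z t = G t + integral {0..t} (\<lambda>s. F s (z s))"
proof -
  define E where "E t = exp (2 * M * t)" for t :: real
  define T where "T z t = G t + integral {0..t} (\<lambda>s. F s (z s))" for z t
  define Z where "Z n = (T ^^ n) (\<lambda>_. 0)" for n
  have Z_0: "Z 0 = (\<lambda>_. 0)" and Z_Suc: "Z (Suc n) = T (Z n)" for n
    by (simp_all add: Z_def)
  have small: "2 * \<delta> * E t \<le> 2 * \<delta> * E \<tau>" "2 * \<delta> * E t \<le> 1" if "t \<in> {0..\<tau>}" for t
  proof -
    have "E t \<le> E \<tau>" using that M by (simp add: E_def)
    then show "2 * \<delta> * E t \<le> 2 * \<delta> * E \<tau>" using \<delta>(1) by (simp add: mult_left_mono)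
    then show "2 * \<delta> * E t \<le> 1" using \<delta>(2) by (simp add: E_def)
  qed
  have int_F: "(\<lambda>s. F s (z s)) integrable_on {0..t}"
    if "continuous_on {0..\<tau>} z" "t \<in> {0..\<tau>}" for z t
    by (rule integrable_continuous_real, rule continuous_on_subset[OF cont_F[OF that(1)]])
      (use that(2) in auto)
  have cont_T: "continuous_on {0..\<tau>} (T z)" if "continuous_on {0..\<tau>} z" for z
    unfolding T_def
    by (intro continuous_on_add cont_G indefinite_integral_continuous_1
        integrable_continuous_real cont_F that)
  have int_E: "((\<lambda>s. M * c * E s) has_integral c / 2 * (E t - 1)) {0..t}" if "t \<ge> 0" for c t
  proof -
    have "((\<lambda>s. c / 2 * E s) has_vector_derivative M * c * E s) (at s within {0..t})" for s
      unfolding E_def by (auto intro!: derivative_eq_intros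
          simp: has_real_derivative_iff_has_vector_derivative[symmetric])
    then have "((\<lambda>s. M * c * E s) has_integral c / 2 * E t - c / 2 * E 0) {0..t}"
      by (intro fundamental_theorem_of_calculus that) auto
    then show ?thesis by (simp add: E_def algebra_simps)
  qed
  \<comment> \<open>The weight doubles the Lipschitz rate, so that integration gains a factor one half.\<close>
  have contract: "norm (T y t - T z t) \<le> c / 2 * E t"
    if y: "continuous_on {0..\<tau>} y" "\<And>t. t \<in> {0..\<tau>} \<Longrightarrow> norm (y t) \<le> 2 * \<delta> * E t"
      and z: "continuous_on {0..\<tau>} z" "\<And>t. t \<in> {0..\<tau>} \<Longrightarrow> norm (z t) \<le> 2 * \<delta> * E t"
      and yz: "\<And>t. t \<in> {0..\<tau>} \<Longrightarrow> norm (y t - z t) \<le> c * E t"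
      and t: "t \<in> {0..\<tau>}" and c: "c \<ge> 0"
    for y z t c
  proof -
    have "norm (F s (y s) - F s (z s)) \<le> M * c * E s" if "s \<in> {0..t}" for s
    proof -
      have s: "s \<in> {0..\<tau>}" using that t by auto
      have "norm (F s (y s) - F s (z s)) \<le> M * norm (y s - z s)"
        using y(2)[OF s] z(2)[OF s] small(2)[OF s] by (intro lip s) auto
      also have "\<dots> \<le> M * (c * E s)" using yz[OF s] M by simp
      finally show ?thesis by simp
    qed
    then have "norm (integral {0..t} (\<lambda>s. F s (y s) - F s (z s))) \<le> integral {0..t} (\<lambda>s. M * c * E s)"
      using int_E[of t c] t
      by (intro integral_norm_bound_integral integrable_diff int_F y z)
        (auto simp: has_integral_iff)
    also have "\<dots> = c / 2 * (E t - 1)" using int_E[of t c] t by (auto simp: has_integral_iff)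
    also have "\<dots> \<le> c / 2 * E t" using c by (simp add: algebra_simps)
    also have "integral {0..t} (\<lambda>s. F s (y s) - F s (z s)) = T y t - T z t"
      unfolding T_def using int_F[OF y(1) t] int_F[OF z(1) t] by (simp add: integral_diff)
    finally show ?thesis .
  qed
  have T_zero: "norm (T (\<lambda>_. 0) t) \<le> \<delta> * E t" if t: "t \<in> {0..\<tau>}" for t
  proof -
    have "integral {0..t} (\<lambda>s. F s 0) = integral {0..t} (\<lambda>s. 0)"
      using t by (intro integral_cong) (auto simp: zero)
    moreover have "\<delta> * 1 \<le> \<delta> * E t" using M t \<delta>(1) by (intro mult_left_mono) (auto simp: E_def)
    ultimately show ?thesis using G[OF t] by (simp add: T_def)
  qed
  have E_pos: "E t > 0" for t by (simp add: E_def)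
  have Z: "continuous_on {0..\<tau>} (Z n) \<and> (\<forall>t\<in>{0..\<tau>}. norm (Z n t) \<le> 2 * \<delta> * E t)" for n
  proof (induction n)
    case 0
    then show ?case using \<delta>(1) E_pos by (auto simp: Z_0 less_imp_le)
  next
    case (Suc n)
    have "norm (T (Z n) t) \<le> 2 * \<delta> * E t" if t: "t \<in> {0..\<tau>}" for t
    proof -
      have "norm (T (Z n) t - T (\<lambda>_. 0) t) \<le> (2 * \<delta>) / 2 * E t"
        using Suc \<delta>(1) E_pos by (intro contract t) (auto simp: less_imp_le)
      then show ?thesis using T_zero[OF t] norm_triangle_sub[of "T (Z n) t" "T (\<lambda>_. 0) t"] by simp
    qed
    then show ?case using Suc cont_T by (simp add: Z_Suc)
  qed
  have diff: "norm (Z (Suc n) t - Z n t) \<le> \<delta> * (1/2)^n * E t" if "t \<in> {0..\<tau>}" for n t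
    using that
  proof (induction n arbitrary: t)
    case 0
    then show ?case using T_zero by (simp add: Z_0 Z_Suc)
  next
    case (Suc n)
    have "norm (T (Z (Suc n)) t - T (Z n) t) \<le> (\<delta> * (1/2)^n) / 2 * E t"
      using Z \<delta>(1) by (intro contract Suc) auto
    then show ?case by (simp add: Z_Suc)
  qed
  define z where "z t = (\<Sum>n. Z (Suc n) t - Z n t)" for t
  have "uniform_limit {0..\<tau>} (\<lambda>n t. \<Sum>i<n. Z (Suc i) t - Z i t) z sequentially"
    unfolding z_def
  proof (rule Weierstrass_m_test)
    fix n t assume t: "t \<in> {0..\<tau>}"
    have "\<delta> * (1/2)^n * E t \<le> \<delta> * (1/2)^n * E \<tau>"
      using t M \<delta>(1) by (intro mult_left_mono) (auto simp: E_def)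
    then show "norm (Z (Suc n) t - Z n t) \<le> \<delta> * (1/2)^n * E \<tau>" using diff[OF t, of n] by simp
  next
    show "summable (\<lambda>n. \<delta> * (1/2)^n * E \<tau>)"
      by (intro summable_mult summable_mult2 summable_geometric) simp
  qed
  moreover have "(\<Sum>i<n. Z (Suc i) t - Z i t) = Z n t" for n t
    using sum_lessThan_telescope[of "\<lambda>i. Z i t" n] by (simp add: Z_0)
  ultimately have lim: "uniform_limit {0..\<tau>} Z z sequentially" by simp
  have cont_z: "continuous_on {0..\<tau>} z"
    by (rule uniform_limit_theorem[OF _ lim]) (use Z in auto)
  have z_bound: "norm (z t) \<le> 2 * \<delta> * E t" if "t \<in> {0..\<tau>}" for t
  proof (rule Lim_norm_ubound)
    show "(\<lambda>n. Z n t) \<longlonglongrightarrow> z t" using tendsto_uniform_limitI[OF lim that] .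
  qed (use Z that in auto)
  have fixed: "z t = T z t" if t: "t \<in> {0..\<tau>}" for t
  proof (rule LIMSEQ_unique)
    show "(\<lambda>n. Z (Suc n) t) \<longlonglongrightarrow> z t"
      using tendsto_uniform_limitI[OF lim t] by (rule LIMSEQ_Suc)
    show "(\<lambda>n. Z (Suc n) t) \<longlonglongrightarrow> T z t"
    proof (rule metric_LIMSEQ_I)
      fix e :: real assume e: "e > 0"
      define c where "c = e / E t"
      have c: "c > 0" using e E_pos by (simp add: c_def)
      obtain N where N: "\<And>n s. n \<ge> N \<Longrightarrow> s \<in> {0..\<tau>} \<Longrightarrow> dist (Z n s) (z s) < c"
        using uniform_limitD[OF lim c] unfolding eventually_sequentially by blast
      have "dist (Z (Suc n) t) (T z t) < e" if "n \<ge> N" for n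
      proof -
        have "norm (Z n s - z s) \<le> c * E s" if s: "s \<in> {0..\<tau>}" for s
        proof -
          have "c * 1 \<le> c * E s" using M s c by (intro mult_left_mono) (auto simp: E_def)
          then show ?thesis using N[OF \<open>n \<ge> N\<close> s] by (simp add: dist_norm)
        qed
        then have "norm (T (Z n) t - T z t) \<le> c / 2 * E t"
          using Z z_bound cont_z c by (intro contract t) auto
        also have "\<dots> < e" using e E_pos[of t] by (simp add: c_def)
        finally show ?thesis by (simp add: Z_Suc dist_norm)
      qed
      then show "\<exists>N. \<forall>n\<ge>N. dist (Z (Suc n) t) (T z t) < e" by blast
    qed
  qed
  show ?thesis
  proof (rule that[OF cont_z])
    fix t assume t: "t \<in> {0..\<tau>}"
    show "norm (z t) \<le> 2 * \<delta> * exp (2 * M * \<tau>)"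
      using z_bound[OF t] small(1)[OF t] by (simp add: E_def)
    show "z t = G t + integral {0..t} (\<lambda>s. F s (z s))" using fixed[OF t] by (simp add: T_def)
  qed
qed

text \<open>The correction \<open>z = x - q\<close> obeys an integral equation with right-hand side
  \<open>- A z - 2 \<Gamma>(q, z) - \<Gamma>(z, z)\<close>, forced by the primitive of the residual of \<open>q\<close>. Its
  Lipschitz constant depends on \<open>q\<close> only through the bound \<open>R\<close>, not through \<open>q'\<close>, which is
  large for a rapidly oscillating curve.\<close>

lemma solution_near_approximate_solution:
  fixes A :: "'x::euclidean_space \<Rightarrow> 'x" and \<Gamma> :: "'x \<Rightarrow> 'x \<Rightarrow> 'x" and q q' w :: "real \<Rightarrow> 'x"
  assumes A: "bounded_linear A" and \<Gamma>: "bounded_bilinear \<Gamma>" and sym: "\<And>x y. \<Gamma> x y = \<Gamma> y x"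
    and KA: "\<And>x. norm (A x) \<le> KA * norm x"
    and KG: "\<And>x y. norm (\<Gamma> x y) \<le> KG * norm x * norm y" "KG \<ge> 0"
    and q: "\<And>t. t \<in> {0..\<tau>} \<Longrightarrow> norm (q t) \<le> R"
    and q': "\<And>t. (q has_vector_derivative q' t) (at t)"
    and cont: "continuous_on {0..\<tau>} q'" "continuous_on {0..\<tau>} w"
    and res: "\<And>t. t \<in> {0..\<tau>} \<Longrightarrow>
                norm (integral {0..t} (\<lambda>s. w s - A (q s) - \<Gamma> (q s) (q s) - q' s)) \<le> \<delta>"
    and M: "KA + 2 * KG * R + 2 * KG \<le> M" "M > 0"
    and \<delta>: "\<delta> \<ge> 0" "2 * \<delta> * exp (2 * M * \<tau>) \<le> 1"
  obtains x where "continuous_on {0..\<tau>} x"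
    and "\<And>t. t \<in> {0..\<tau>} \<Longrightarrow> ((\<lambda>s. w s - A (x s) - \<Gamma> (x s) (x s)) has_integral x t - q 0) {0..t}"
    and "\<And>t. t \<in> {0..\<tau>} \<Longrightarrow> norm (x t - q t) \<le> 2 * \<delta> * exp (2 * M * \<tau>)"
proof -
  interpret A: bounded_linear A by fact
  interpret G: bounded_bilinear \<Gamma> by fact
  define r where "r s = w s - A (q s) - \<Gamma> (q s) (q s) - q' s" for s
  define F where "F s z = - A z - 2 *\<^sub>R \<Gamma> (q s) z - \<Gamma> z z" for s z
  have cont_q: "continuous_on {0..\<tau>} q"
    by (rule continuous_on_vector_derivative[OF has_vector_derivative_at_within[OF q']])
  have cont_r: "continuous_on {0..\<tau>} r"
    unfolding r_def by (intro continuous_intros cont cont_q A.continuous_on G.continuous_on)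
  have cont_F: "continuous_on {0..\<tau>} (\<lambda>s. F s (z s))" if "continuous_on {0..\<tau>} z" for z
    unfolding F_def by (intro continuous_intros that cont_q A.continuous_on G.continuous_on)
  have lip: "norm (F s y - F s z) \<le> M * norm (y - z)"
    if s: "s \<in> {0..\<tau>}" and y: "norm y \<le> 1" and z: "norm z \<le> 1" for s y z
  proof -
    have "\<Gamma> y y - \<Gamma> z z = \<Gamma> y (y - z) + \<Gamma> z (y - z)"
      by (simp add: G.diff_right sym)
    then have "F s y - F s z = - A (y - z) - 2 *\<^sub>R \<Gamma> (q s) (y - z) - (\<Gamma> y (y - z) + \<Gamma> z (y - z))"
      by (simp add: F_def A.diff G.diff_right algebra_simps)
    also have "norm \<dots> \<le> norm (A (y - z)) + 2 * norm (\<Gamma> (q s) (y - z))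
        + (norm (\<Gamma> y (y - z)) + norm (\<Gamma> z (y - z)))"
    proof -
      have "norm (- a - 2 *\<^sub>R b - (c + d)) \<le> norm a + 2 * norm b + (norm c + norm d)" for a b c d :: 'x
        using norm_triangle_ineq4[of "- a - 2 *\<^sub>R b" "c + d"] norm_triangle_ineq4[of "- a" "2 *\<^sub>R b"]
          norm_triangle_ineq[of c d] by simp
      then show ?thesis .
    qed
    also have "\<dots> \<le> KA * norm (y - z) + 2 * (KG * R * norm (y - z))
        + (KG * 1 * norm (y - z) + KG * 1 * norm (y - z))"
    proof -
      have "norm (\<Gamma> a (y - z)) \<le> KG * b * norm (y - z)" if "norm a \<le> b" for a b
        using KG(1)[of a "y - z"] that KG(2)
        by (meson mult_left_mono mult_right_mono norm_ge_zero order_trans)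
      from this[OF q[OF s]] this[OF y] this[OF z] KA[of "y - z"] show ?thesis by linarith
    qed
    also have "\<dots> = (KA + 2 * KG * R + 2 * KG) * norm (y - z)" by (simp add: algebra_simps)
    also have "\<dots> \<le> M * norm (y - z)" using M(1) by (simp add: mult_right_mono)
    finally show ?thesis .
  qed
  obtain z where cont_z: "continuous_on {0..\<tau>} z"
    and z_bound: "\<And>t. t \<in> {0..\<tau>} \<Longrightarrow> norm (z t) \<le> 2 * \<delta> * exp (2 * M * \<tau>)"
    and z: "\<And>t. t \<in> {0..\<tau>} \<Longrightarrow> z t = integral {0..t} r + integral {0..t} (\<lambda>s. F s (z s))"
  proof (rule small_forcing_integral_equation[of M \<tau> F "\<lambda>t. integral {0..t} r" \<delta>])
    show "F s 0 = 0" for s by (simp add: F_def A.zero G.zero_right)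
    show "continuous_on {0..\<tau>} (\<lambda>t. integral {0..t} r)"
      by (intro indefinite_integral_continuous_1 integrable_continuous_real cont_r)
    show "norm (integral {0..t} r) \<le> \<delta>" if "t \<in> {0..\<tau>}" for t
      using res[OF that] by (simp add: r_def[abs_def])
  qed (use lip cont_F M \<delta> in auto)
  show ?thesis
  proof (rule that[of "\<lambda>t. q t + z t"])
    show "continuous_on {0..\<tau>} (\<lambda>t. q t + z t)" by (intro continuous_intros cont_q cont_z)
    fix t assume t: "t \<in> {0..\<tau>}"
    show "norm (q t + z t - q t) \<le> 2 * \<delta> * exp (2 * M * \<tau>)" using z_bound[OF t] by simp
    have int: "(h has_integral integral {0..t} h) {0..t}" if "continuous_on {0..\<tau>} h" for h :: "real \<Rightarrow> 'x"
      by (rule integrable_integral, rule integrable_continuous_real, rule continuous_on_subset[OF that])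
        (use t in auto)
    have "(q' has_integral q t - q 0) {0..t}"
      using t q' by (intro fundamental_theorem_of_calculus) (auto intro: has_vector_derivative_at_within)
    from has_integral_add[OF this has_integral_add[OF int[OF cont_r] int[OF cont_F[OF cont_z]]]]
    have "((\<lambda>s. q' s + (r s + F s (z s))) has_integral q t + z t - q 0) {0..t}"
      by (simp add: z[OF t] algebra_simps)
    moreover have "q' s + (r s + F s (z s)) =
        w s - A (q s + z s) - \<Gamma> (q s + z s) (q s + z s)" for s
      by (simp add: r_def F_def A.add G.add_left G.add_right sym[of "z s" "q s"] scaleR_2)
    ultimately show "((\<lambda>s. w s - A (q s + z s) - \<Gamma> (q s + z s) (q s + z s))
        has_integral q t + z t - q 0) {0..t}" by simp
  qed
qed

section \<open>Rapid oscillations average out\<close>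

text \<open>Convergence to 0 in the relaxation norm, for continuous functions.\<close>

definition weakly_null :: "real \<Rightarrow> (nat \<Rightarrow> real \<Rightarrow> 'a::euclidean_space) \<Rightarrow> bool" where
  "weakly_null \<tau> g \<longleftrightarrow> (\<forall>k. continuous_on {0..\<tau>} (g k)) \<and>
     uniform_limit {0..\<tau>} (\<lambda>k t. integral {0..t} (g k)) (\<lambda>_. 0) sequentially"

lemma weakly_null_zero [simp]: "weakly_null \<tau> (\<lambda>_ _. 0)"
  by (simp add: weakly_null_def uniform_limit_const)

lemma weakly_null_add:
  assumes f: "weakly_null \<tau> f" and g: "weakly_null \<tau> g"
  shows "weakly_null \<tau> (\<lambda>k s. f k s + g k s)"
proof -
  have "uniform_limit {0..\<tau>} (\<lambda>k t. integral {0..t} (f k) + integral {0..t} (g k)) (\<lambda>_. 0 + 0) sequentially"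
    using f g by (intro uniform_limit_add) (auto simp: weakly_null_def)
  moreover have "integral {0..t} (\<lambda>s. f k s + g k s) = integral {0..t} (f k) + integral {0..t} (g k)"
    if "t \<in> {0..\<tau>}" for k t
    using f g that
    by (intro integral_add integrable_continuous_real)
      (auto simp: weakly_null_def intro: continuous_on_subset[of "{0..\<tau>}"])
  ultimately have "uniform_limit {0..\<tau>} (\<lambda>k t. integral {0..t} (\<lambda>s. f k s + g k s)) (\<lambda>_. 0) sequentially"
    by (subst uniform_limit_cong') auto
  then show ?thesis
    using f g by (auto simp: weakly_null_def intro: continuous_on_add)
qed

lemma weakly_null_sum:
  "(\<And>i. i \<in> I \<Longrightarrow> weakly_null \<tau> (g i)) \<Longrightarrow> weakly_null \<tau> (\<lambda>k s. \<Sum>i\<in>I. g i k s)"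
  by (induction I rule: infinite_finite_induct) (simp_all add: weakly_null_add)

lemma weakly_null_eventually_small:
  assumes "weakly_null \<tau> g" "d > 0"
  shows "\<forall>\<^sub>F k in sequentially. \<forall>t\<in>{0..\<tau>}. norm (integral {0..t} (g k)) < d"
  using uniform_limitD[OF conjunct2[OF assms(1)[unfolded weakly_null_def]] assms(2)]
  by (simp add: dist_norm)

text \<open>Riemann--Lebesgue, uniformly in the upper limit: integrating by parts moves the derivative
  to \<open>h\<close> and gains a factor \<open>1/(k w)\<close>.\<close>

lemma weakly_null_wave:
  fixes h :: "real \<Rightarrow> 'a::euclidean_space"
  assumes h: "polynomial_function h" and w: "w \<noteq> 0"
  shows "weakly_null \<tau> (\<lambda>k s. cos (real k * w * s + \<theta>) *\<^sub>R h s)"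
proof -
  obtain h' where h': "polynomial_function h'" "\<And>x. (h has_vector_derivative h' x) (at x)"
    using has_vector_derivative_polynomial_function[OF h] by blast
  have cont: "continuous_on S h" "continuous_on S h'" for S
    using h h'(1) by (auto intro: continuous_on_polymonial_function)
  have bound: "\<exists>C>0. \<forall>t\<in>{0..\<tau>}. norm (f t) \<le> C" if "continuous_on {0..\<tau>} f" for f :: "real \<Rightarrow> 'a"
    using compact_imp_bounded[OF compact_continuous_image[OF that]] by (auto simp: bounded_pos)
  from bound[OF cont(1)] obtain C where C: "C > 0" "\<And>t. t \<in> {0..\<tau>} \<Longrightarrow> norm (h t) \<le> C" by auto
  from bound[OF cont(2)] obtain C' where C': "C' > 0" "\<And>t. t \<in> {0..\<tau>} \<Longrightarrow> norm (h' t) \<le> C'" by auto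
  define K where "K = 2 * C + \<bar>\<tau>\<bar> * C'"
  have est: "norm (integral {0..t} (\<lambda>s. cos (real k * w * s + \<theta>) *\<^sub>R h s)) \<le> K / (real k * \<bar>w\<bar>)"
    if t: "t \<in> {0..\<tau>}" and k: "k > 0" for t k
  proof -
    define \<omega> where "\<omega> = real k * w"
    have \<omega>: "\<omega> \<noteq> 0" using w k by (simp add: \<omega>_def)
    define S where "S s = sin (\<omega> * s + \<theta>) / \<omega>" for s
    have S: "(S has_vector_derivative cos (\<omega> * s + \<theta>)) (at s)" for s
      unfolding S_def using \<omega>
      by (auto intro!: derivative_eq_intros simp: has_real_derivative_iff_has_vector_derivative[symmetric])
    have cont_S: "continuous_on X S" for X
      by (rule continuous_on_vector_derivative[OF has_vector_derivative_at_within[OF S]])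
    have norm_S: "\<bar>S s\<bar> \<le> 1 / \<bar>\<omega>\<bar>" for s
      by (simp add: S_def divide_right_mono)
    have int: "(\<lambda>s. S s *\<^sub>R h' s) integrable_on {0..t}"
      by (intro integrable_continuous_real continuous_intros cont cont_S)
    have "((\<lambda>s. cos (\<omega> * s + \<theta>) *\<^sub>R h s) has_integral
        S t *\<^sub>R h t - S 0 *\<^sub>R h 0 - integral {0..t} (\<lambda>s. S s *\<^sub>R h' s)) {0..t}"
      by (rule integration_by_parts[OF bounded_bilinear_scaleR, where f = S and g' = h'])
        (use t S h' cont cont_S int in \<open>auto simp: has_integral_iff\<close>)
    then have "integral {0..t} (\<lambda>s. cos (\<omega> * s + \<theta>) *\<^sub>R h s) =
        S t *\<^sub>R h t - S 0 *\<^sub>R h 0 - integral {0..t} (\<lambda>s. S s *\<^sub>R h' s)"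
      by (rule integral_unique)
    also have "norm \<dots> \<le> norm (S t *\<^sub>R h t) + norm (S 0 *\<^sub>R h 0)
        + norm (integral {0..t} (\<lambda>s. S s *\<^sub>R h' s))"
      by (rule order_trans[OF norm_triangle_ineq4 add_right_mono[OF norm_triangle_ineq4]])
    also have "\<dots> \<le> 1 / \<bar>\<omega>\<bar> * C + 1 / \<bar>\<omega>\<bar> * C + 1 / \<bar>\<omega>\<bar> * C' * \<bar>\<tau>\<bar>"
    proof (intro add_mono)
      show "norm (S t *\<^sub>R h t) \<le> 1 / \<bar>\<omega>\<bar> * C" "norm (S 0 *\<^sub>R h 0) \<le> 1 / \<bar>\<omega>\<bar> * C"
        unfolding norm_scaleR using C(2) t by (intro mult_mono norm_S; simp)+
      have "norm (integral {0..t} (\<lambda>s. S s *\<^sub>R h' s)) \<le> 1 / \<bar>\<omega>\<bar> * C' * (t - 0)"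
      proof (rule integral_bound)
        show "norm (S s *\<^sub>R h' s) \<le> 1 / \<bar>\<omega>\<bar> * C'" if "s \<in> {0..t}" for s
          unfolding norm_scaleR using C'(2) t that by (intro mult_mono norm_S; simp)
      qed (use t in \<open>auto intro!: continuous_intros cont cont_S\<close>)
      also have "\<dots> \<le> 1 / \<bar>\<omega>\<bar> * C' * \<bar>\<tau>\<bar>"
        using t C'(1) by (intro mult_left_mono) auto
      finally show "norm (integral {0..t} (\<lambda>s. S s *\<^sub>R h' s)) \<le> 1 / \<bar>\<omega>\<bar> * C' * \<bar>\<tau>\<bar>" .
    qed
    also have "\<dots> = K / (real k * \<bar>w\<bar>)"
      using w k by (simp add: K_def \<omega>_def abs_mult field_simps)
    finally show ?thesis by (simp add: \<omega>_def)
  qed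
  have "uniform_limit {0..\<tau>}
      (\<lambda>k t. integral {0..t} (\<lambda>s. cos (real k * w * s + \<theta>) *\<^sub>R h s)) (\<lambda>_. 0) sequentially"
  proof (rule uniform_limitI)
    fix e :: real assume e: "e > 0"
    have "(\<lambda>k. K / \<bar>w\<bar> / real k) \<longlonglongrightarrow> 0" by (rule lim_const_over_n)
    then have "\<forall>\<^sub>F k in sequentially. K / \<bar>w\<bar> / real k < e"
      using e by (rule order_tendstoD)
    with eventually_gt_at_top[of 0]
    show "\<forall>\<^sub>F k in sequentially. \<forall>t\<in>{0..\<tau>}.
        dist (integral {0..t} (\<lambda>s. cos (real k * w * s + \<theta>) *\<^sub>R h s)) 0 < e"
    proof eventually_elim
      case (elim k)
      then have "K / (real k * \<bar>w\<bar>) < e" by (simp add: field_simps)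
      then show ?case using est[OF _ elim(1)] by (fastforce simp: dist_norm)
    qed
  qed
  then show ?thesis
    by (auto simp: weakly_null_def intro!: continuous_intros cont)
qed

section \<open>Trigonometric polynomials as smooth controls\<close>

text \<open>The phase \<open>\<theta>\<close> makes sines and cosines instances of one rule, and the case
  \<open>w = 0\<close> gives the polynomials.\<close>

inductive trig_polynomial :: "(real \<Rightarrow> 'a::euclidean_space) \<Rightarrow> bool" where
  wave: "polynomial_function h \<Longrightarrow> trig_polynomial (\<lambda>t. cos (w * t + \<theta>) *\<^sub>R h t)"
| add: "trig_polynomial g \<Longrightarrow> trig_polynomial h \<Longrightarrow> trig_polynomial (\<lambda>t. g t + h t)"

lemma trig_polynomial_polynomial: "polynomial_function h \<Longrightarrow> trig_polynomial h"
  using trig_polynomial.wave[of h 0 0] by simp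

lemma trig_polynomial_sum:
  "(\<And>i. i \<in> I \<Longrightarrow> trig_polynomial (g i)) \<Longrightarrow> trig_polynomial (\<lambda>t. \<Sum>i\<in>I. g i t)"
  by (induction I rule: infinite_finite_induct)
    (simp_all add: trig_polynomial.add trig_polynomial_polynomial)

lemma trig_polynomial_derivative:
  assumes "trig_polynomial h"
  shows "\<exists>h'. trig_polynomial h' \<and> (\<forall>t. (h has_vector_derivative h' t) (at t))"
  using assms
proof induction
  case (wave h w \<theta>)
  obtain h' where h': "polynomial_function h'" "\<And>x. (h has_vector_derivative h' x) (at x)"
    using has_vector_derivative_polynomial_function[OF wave] by blast
  have "((\<lambda>t. cos (w * t + \<theta>) *\<^sub>R h t) has_vector_derivative
      (cos (w * t + (\<theta> + pi / 2)) *\<^sub>R (w *\<^sub>R h t) + cos (w * t + \<theta>) *\<^sub>R h' t)) (at t)" for t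
  proof -
    have "((\<lambda>t. cos (w * t + \<theta>)) has_real_derivative - sin (w * t + \<theta>) * w) (at t)"
      by (auto intro!: derivative_eq_intros)
    from has_vector_derivative_scaleR[OF this h'(2)]
    have "((\<lambda>t. cos (w * t + \<theta>) *\<^sub>R h t) has_vector_derivative
        cos (w * t + \<theta>) *\<^sub>R h' t + (- sin (w * t + \<theta>) * w) *\<^sub>R h t) (at t)" .
    moreover have "cos (w * t + (\<theta> + pi / 2)) = - sin (w * t + \<theta>)"
      using minus_sin_cos_eq[of "w * t + \<theta>"] by (simp add: add.assoc)
    ultimately show ?thesis by (simp add: add.commute)
  qed
  then show ?case
    using wave h'(1)
    by (intro exI[of _ "\<lambda>t. cos (w * t + (\<theta> + pi / 2)) *\<^sub>R (w *\<^sub>R h t) + cos (w * t + \<theta>) *\<^sub>R h' t"]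
        conjI allI trig_polynomial.intros polynomial_function_cmul)
next
  case (add g h)
  then obtain g' h' where "trig_polynomial g'" "\<forall>t. (g has_vector_derivative g' t) (at t)"
    "trig_polynomial h'" "\<forall>t. (h has_vector_derivative h' t) (at t)" by blast
  then show ?case
    by (intro exI[of _ "\<lambda>t. g' t + h' t"]) (auto intro: trig_polynomial.add has_vector_derivative_add)
qed

lemma trig_polynomial_continuous_on:
  assumes "trig_polynomial h"
  shows "continuous_on S h"
proof -
  obtain h' where "\<And>t. (h has_vector_derivative h' t) (at t)"
    using trig_polynomial_derivative[OF assms] by blast
  then show ?thesis
    by (rule continuous_on_vector_derivative[OF has_vector_derivative_at_within])
qed

text \<open>Closure under differentiation yields the whole sequence of derivatives by dependent choice.\<close>

lemma trig_polynomial_smooth_on: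
  assumes "trig_polynomial h"
  shows "smooth_on S h"
proof -
  have "\<exists>D. \<forall>n. (trig_polynomial (D n) \<and> (n = 0 \<longrightarrow> D n = h)) \<and>
      (\<forall>t. (D n has_vector_derivative D (Suc n) t) (at t))"
    using assms trig_polynomial_derivative by (intro dependent_nat_choice) auto
  then show ?thesis
    unfolding smooth_on_def by (metis has_vector_derivative_at_within)
qed

lemma smooth_on_imp_L2_on:
  assumes "smooth_on {0..\<tau>} u"
  shows "L2_on \<tau> u"
proof -
  obtain D where D: "\<And>t. t \<in> {0..\<tau>} \<Longrightarrow> D 0 t = u t"
    "\<And>t. t \<in> {0..\<tau>} \<Longrightarrow> (D 0 has_vector_derivative D (Suc 0) t) (at t within {0..\<tau>})"
    using assms unfolding smooth_on_def by blast
  have "continuous_on {0..\<tau>} (D 0)"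
    using D(2) by (rule continuous_on_vector_derivative)
  then have u: "continuous_on {0..\<tau>} u" by (rule continuous_on_eq) (use D(1) in auto)
  have "integrable (lebesgue_on {0..\<tau>}) (\<lambda>s. (norm (u s))\<^sup>2)"
    by (intro continuous_imp_integrable_real continuous_intros u)
  moreover have "u \<in> borel_measurable (lebesgue_on {0..\<tau>})"
    using u by (intro continuous_imp_measurable_on_sets_lebesgue) auto
  ultimately show ?thesis by (simp add: L2_on_def)
qed

section \<open>Superposed waves and their mean effect\<close>

lemma polynomial_function_bounded_bilinear:
  fixes p :: "real \<Rightarrow> 'a::euclidean_space" and q :: "real \<Rightarrow> 'b::euclidean_space"
    and \<Gamma> :: "'a \<Rightarrow> 'b \<Rightarrow> 'c::euclidean_space"
  assumes "bounded_bilinear \<Gamma>" "polynomial_function p" "polynomial_function q"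
  shows "polynomial_function (\<lambda>t. \<Gamma> (p t) (q t))"
proof -
  interpret bounded_bilinear \<Gamma> by fact
  have "\<Gamma> (p t) (q t) = (\<Sum>j\<in>Basis. \<Sum>i\<in>Basis. (q t \<bullet> j) *\<^sub>R (p t \<bullet> i) *\<^sub>R \<Gamma> i j)" for t
  proof -
    have "\<Gamma> (p t) (q t) = \<Gamma> (\<Sum>i\<in>Basis. (p t \<bullet> i) *\<^sub>R i) (\<Sum>j\<in>Basis. (q t \<bullet> j) *\<^sub>R j)"
      by (simp add: euclidean_representation)
    also have "\<dots> = (\<Sum>j\<in>Basis. \<Sum>i\<in>Basis. (q t \<bullet> j) *\<^sub>R (p t \<bullet> i) *\<^sub>R \<Gamma> i j)"
      unfolding sum_left sum_right scaleR_left scaleR_right scaleR_sum_right by (rule refl)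
    finally show ?thesis .
  qed
  then show ?thesis
    by (simp only: polynomial_function_sum polynomial_function_mult finite_Basis
        polynomial_function_inner[OF assms(2)] polynomial_function_inner[OF assms(3)]
        polynomial_function_const)
qed

text \<open>Every coordinate \<open>e\<close> of \<open>\<eta>\<close> is \<open>((e + 1)/2)\<^sup>2 - ((e - 1)/2)\<^sup>2\<close>, so the
  directions can be taken among the basis vectors and their negatives. Squares of polynomials,
  rather than nonnegative coefficients, make the square roots smooth.\<close>

lemma polynomial_eq_sum_squares:
  fixes \<eta> :: "real \<Rightarrow> 'x::euclidean_space"
  assumes "polynomial_function \<eta>"
  obtains N :: nat and a :: "nat \<Rightarrow> real \<Rightarrow> real" and \<gamma> :: "nat \<Rightarrow> 'x"
  where "\<And>j. polynomial_function (a j)" and "\<And>t. \<eta> t = (\<Sum>j<N. (a j t)\<^sup>2 *\<^sub>R \<gamma> j)"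
proof -
  define J where "J = (Basis :: 'x set) \<times> {-1, 1 :: real}"
  define \<alpha> where "\<alpha> t = (\<lambda>(b, s). (\<eta> t \<bullet> b + s) / 2)" for t
  define g where "g = (\<lambda>(b :: 'x, s :: real). s *\<^sub>R b)"
  obtain h where h: "bij_betw h {0..<card J} J"
    using ex_bij_betw_nat_finite[of J] by (auto simp: J_def)
  have "\<eta> t = (\<Sum>j<card J. (\<alpha> t (h j))\<^sup>2 *\<^sub>R g (h j))" for t
  proof -
    have "(\<Sum>j<card J. (\<alpha> t (h j))\<^sup>2 *\<^sub>R g (h j)) = (\<Sum>i\<in>J. (\<alpha> t i)\<^sup>2 *\<^sub>R g i)"
      using sum.reindex_bij_betw[OF h, of "\<lambda>i. (\<alpha> t i)\<^sup>2 *\<^sub>R g i"] by (simp add: atLeast0LessThan)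
    also have "\<dots> = (\<Sum>b\<in>Basis. \<Sum>s\<in>{-1, 1}. (\<alpha> t (b, s))\<^sup>2 *\<^sub>R g (b, s))"
      unfolding J_def by (subst sum.cartesian_product) (simp add: case_prod_beta)
    also have "\<dots> = (\<Sum>b\<in>Basis. (\<eta> t \<bullet> b) *\<^sub>R b)"
      by (intro sum.cong refl)
        (simp add: \<alpha>_def g_def scaleR_left_diff_distrib[symmetric] scaleR_left_distrib[symmetric]
          power2_eq_square field_simps)
    finally show ?thesis by (simp add: euclidean_representation)
  qed
  moreover have "polynomial_function (\<lambda>t. \<alpha> t (h j))" for j
  proof -
    have "polynomial_function (\<lambda>t. (1/2) *\<^sub>R (\<eta> t \<bullet> fst (h j) + snd (h j)))"
      using assms by (intro polynomial_function_cmul polynomial_function_add polynomial_function_inner) auto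
    then show ?thesis by (simp add: \<alpha>_def case_prod_beta)
  qed
  ultimately show ?thesis using that[of "\<lambda>j t. \<alpha> t (h j)" "\<lambda>j. g (h j)" "card J"] by blast
qed

text \<open>The factor \<open>\<surd>2\<close> normalises the mean of the squared wave to 1. For \<open>c \<noteq> 0\<close> the
  differences of two distinct frequencies \<open>k c (j + 1)\<close> and the sums of any two tend to infinity
  in absolute value with \<open>k\<close>.\<close>

definition oscillation ::
  "real \<Rightarrow> nat \<Rightarrow> (nat \<Rightarrow> real \<Rightarrow> real) \<Rightarrow> (nat \<Rightarrow> 'a::euclidean_space) \<Rightarrow> nat \<Rightarrow> real \<Rightarrow> 'a" where
  "oscillation c N a \<xi> k t = (\<Sum>j<N. sin (real k * (c * real (Suc j)) * t) *\<^sub>R (sqrt 2 * a j t) *\<^sub>R \<xi> j)"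

lemma sin_eq_cos_shift: "sin x = cos (x + (- pi / 2))" for x :: real
  by (simp add: cos_diff)

lemma linear_oscillation:
  "linear L \<Longrightarrow> L (oscillation c N a \<xi> k t) = oscillation c N a (\<lambda>j. L (\<xi> j)) k t"
  by (simp add: oscillation_def linear_sum linear_scale)

lemma polynomial_function_mult_real:
  "polynomial_function f \<Longrightarrow> polynomial_function (\<lambda>t. c * f t)" for f :: "real \<Rightarrow> real"
  using polynomial_function_cmul[of f c] by simp

lemma oscillation_trig_polynomial:
  assumes "\<And>j. polynomial_function (a j)"
  shows "trig_polynomial (oscillation c N a \<xi> k)"
proof -
  have "trig_polynomial (\<lambda>t. \<Sum>j<N. cos (real k * (c * real (Suc j)) * t + (- pi / 2)) *\<^sub>R (sqrt 2 * a j t) *\<^sub>R \<xi> j)"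
    using assms
    by (intro trig_polynomial_sum trig_polynomial.wave polynomial_function_mult
        polynomial_function_mult_real polynomial_function_const)
  then show ?thesis
    by (simp only: oscillation_def[abs_def] sin_eq_cos_shift)
qed

lemma oscillation_bounded:
  assumes "\<And>j. polynomial_function (a j)"
  obtains R where "\<And>k t. t \<in> {0..\<tau>} \<Longrightarrow> norm (oscillation c N a \<xi> k t) \<le> R"
proof -
  have "\<exists>C. \<forall>t\<in>{0..\<tau>}. \<bar>a j t\<bar> \<le> C" for j
    using compact_imp_bounded[OF compact_continuous_image[OF continuous_on_polymonial_function[OF assms] compact_Icc]]
    by (auto simp: bounded_iff)
  then obtain C where C: "\<And>j t. t \<in> {0..\<tau>} \<Longrightarrow> \<bar>a j t\<bar> \<le> C j" by metis
  show ?thesis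
  proof (rule that)
    fix k t assume t: "t \<in> {0..\<tau>}"
    have "norm (sin \<theta> *\<^sub>R (sqrt 2 * a j t) *\<^sub>R \<xi> j) \<le> 1 * (sqrt 2 * C j * norm (\<xi> j))" for \<theta> j
      unfolding norm_scaleR real_norm_def abs_mult using C[OF t, of j]
      by (intro mult_mono) auto
    then show "norm (oscillation c N a \<xi> k t) \<le> (\<Sum>j<N. 1 * (sqrt 2 * C j * norm (\<xi> j)))"
      unfolding oscillation_def by (intro sum_norm_le) blast
  qed
qed

text \<open>Terms that are linear in the oscillation average out, also when their coefficients vary
  polynomially in time.\<close>

lemma weakly_null_multiple_oscillation:
  fixes a :: "nat \<Rightarrow> real \<Rightarrow> real"
  assumes a: "\<And>j. polynomial_function (a j)" and c: "c \<noteq> 0"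
    and L: "\<And>j. polynomial_function (\<lambda>s. L s (\<xi> j))" "\<And>s. linear (L s)"
  shows "weakly_null \<tau> (\<lambda>k s. L s (oscillation c N a \<xi> k s))"
proof -
  have "weakly_null \<tau> (\<lambda>k s. \<Sum>j<N. cos (real k * (c * real (Suc j)) * s + (- pi / 2)) *\<^sub>R (sqrt 2 * a j s) *\<^sub>R L s (\<xi> j))"
    using c a L(1)
    by (intro weakly_null_sum weakly_null_wave polynomial_function_mult
        polynomial_function_mult_real) auto
  then show ?thesis
    by (simp only: oscillation_def linear_sum[OF L(2)] linear_scale[OF L(2)] sin_eq_cos_shift)
qed

text \<open>By \<open>2 sin \<alpha> sin \<beta> = cos (\<alpha> - \<beta>) - cos (\<alpha> + \<beta>)\<close> every product of two
  waves splits into waves of higher frequency, except that for equal waves the difference frequency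
  is 0. These diagonal terms are what remains in the mean.\<close>

lemma weakly_null_bilinear_oscillation:
  fixes a :: "nat \<Rightarrow> real \<Rightarrow> real"
  assumes \<Gamma>: "bounded_bilinear \<Gamma>" and a: "\<And>j. polynomial_function (a j)" and c: "c \<noteq> 0"
  shows "weakly_null \<tau> (\<lambda>k s. (\<Sum>j<N. (a j s)\<^sup>2 *\<^sub>R \<Gamma> (\<xi> j) (\<xi> j))
           - \<Gamma> (oscillation c N a \<xi> k s) (oscillation c N a \<xi> k s))"
proof -
  interpret bounded_bilinear \<Gamma> by fact
  define p where "p i j s = (a i s * a j s) *\<^sub>R \<Gamma> (\<xi> j) (\<xi> i)" for i j s
  define D where "D i j k s = cos (real k * (c * (real (Suc i) - real (Suc j))) * s + 0) *\<^sub>R (- p i j s)" for i j k s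
  define S where "S i j k s = cos (real k * (c * (real (Suc i) + real (Suc j))) * s + 0) *\<^sub>R p i j s" for i j k s
  have p: "polynomial_function (p i j)" for i j
    using a polynomial_function_mult[of "\<lambda>s. a i s" "\<lambda>s. a j s"]
    unfolding p_def[abs_def] by (intro polynomial_function_mult[where g = "\<lambda>_. \<Gamma> (\<xi> j) (\<xi> i)"]) auto
  have "weakly_null \<tau> (\<lambda>k s. \<Sum>i<N. \<Sum>j<N. (if i = j then 0 else D i j k s) + S i j k s)"
  proof (intro weakly_null_sum weakly_null_add)
    fix i j
    show "weakly_null \<tau> (\<lambda>k s. if i = j then 0 else D i j k s)"
    proof (cases "i = j")
      case False
      have "weakly_null \<tau> (D i j)"
        unfolding D_def using c False by (intro weakly_null_wave polynomial_function_minus p) simp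
      then show ?thesis using False by simp
    qed simp
    show "weakly_null \<tau> (S i j)"
      unfolding S_def using c p by (intro weakly_null_wave) auto
  qed
  moreover have "(\<Sum>j<N. (a j s)\<^sup>2 *\<^sub>R \<Gamma> (\<xi> j) (\<xi> j)) - \<Gamma> (oscillation c N a \<xi> k s) (oscillation c N a \<xi> k s)
      = (\<Sum>i<N. \<Sum>j<N. (if i = j then 0 else D i j k s) + S i j k s)" for k s
  proof -
    define \<theta> where "\<theta> i = real k * (c * real (Suc i)) * s" for i
    have waves: "sin (\<theta> i) *\<^sub>R (sqrt 2 * a i s) *\<^sub>R sin (\<theta> j) *\<^sub>R (sqrt 2 * a j s) *\<^sub>R \<Gamma> (\<xi> j) (\<xi> i)
        = - (D i j k s + S i j k s)" for i j
    proof -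
      have "sin (\<theta> i) * (sqrt 2 * a i s) * (sin (\<theta> j) * (sqrt 2 * a j s)) = 2 * (sin (\<theta> i) * sin (\<theta> j)) * (a i s * a j s)"
        by simp
      also have "\<dots> = (cos (\<theta> i - \<theta> j) - cos (\<theta> i + \<theta> j)) * (a i s * a j s)"
        by (simp add: cos_diff cos_add)
      finally have "sin (\<theta> i) *\<^sub>R (sqrt 2 * a i s) *\<^sub>R sin (\<theta> j) *\<^sub>R (sqrt 2 * a j s) *\<^sub>R \<Gamma> (\<xi> j) (\<xi> i)
          = (cos (\<theta> i - \<theta> j) - cos (\<theta> i + \<theta> j)) *\<^sub>R p i j s"
        by (simp add: p_def mult.assoc)
      also have "\<theta> i - \<theta> j = real k * (c * (real (Suc i) - real (Suc j))) * s"
        by (simp add: \<theta>_def algebra_simps)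
      also have "\<theta> i + \<theta> j = real k * (c * (real (Suc i) + real (Suc j))) * s"
        by (simp add: \<theta>_def algebra_simps)
      finally show ?thesis by (simp add: D_def S_def scaleR_left_diff_distrib)
    qed
    have "\<Gamma> (oscillation c N a \<xi> k s) (oscillation c N a \<xi> k s)
        = (\<Sum>i<N. \<Sum>j<N. - (D i j k s + S i j k s))"
      unfolding oscillation_def \<theta>_def[symmetric] sum_left sum_right scaleR_left scaleR_right scaleR_sum_right waves
      by (rule refl)
    moreover have "(\<Sum>j<N. (a j s)\<^sup>2 *\<^sub>R \<Gamma> (\<xi> j) (\<xi> j)) = (\<Sum>i<N. \<Sum>j<N. if i = j then - D i j k s else 0)"
      by (simp add: D_def p_def power2_eq_square)
    ultimately show ?thesis
      by (simp only: sum_subtractf[symmetric]) (intro sum.cong refl, auto)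
  qed
  ultimately show ?thesis by simp
qed

section \<open>Tracking\<close>

text \<open>The constants are chosen in the order polynomial \<open>p\<close>, amplitudes \<open>a\<close> and directions
  \<open>\<gamma>\<close>, bounds \<open>R\<close> and \<open>M\<close>, tolerance \<open>\<delta>\<close>, and last the frequency \<open>k\<close>. The control consists
  of the slow part \<open>\<Sum>j. a\<^sub>j\<^sup>2 U \<gamma>\<^sub>j\<close> and the derivative of the oscillation.\<close>

lemma continuous_tracking:
  fixes A :: "'x::euclidean_space \<Rightarrow> 'x" and B :: "'u::euclidean_space \<Rightarrow> 'x"
  assumes A: "bounded_linear A" and B: "bounded_linear B" and \<Gamma>: "bounded_bilinear \<Gamma>"
    and sym: "\<And>x y. \<Gamma> x y = \<Gamma> y x"
    and f: "\<And>x. f x = \<Gamma> x x"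
    and solvable: "\<And>\<gamma>. \<exists>u \<xi>. \<gamma> = B u - f (B \<xi>)"
    and \<tau>: "\<tau> > 0"
    and \<psi>: "continuous_on {0..\<tau>} \<psi>" and \<epsilon>: "\<epsilon> > 0"
  shows "\<exists>u x. smooth_on {0..\<tau>} u \<and> is_solution A B f \<tau> u (\<psi> 0) x \<and>
    norm (x \<tau> - \<psi> \<tau>) + relax_norm \<tau> (\<lambda>t. x t - \<psi> t) < \<epsilon>"
proof -
  interpret A: bounded_linear A by fact
  interpret B: bounded_linear B by fact
  interpret G: bounded_bilinear \<Gamma> by fact
  obtain U \<Xi> where U\<Xi>: "\<And>\<gamma>. \<gamma> = B (U \<gamma>) - f (B (\<Xi> \<gamma>))"
    using solvable by metis
  obtain KA where KA: "KA > 0" "\<And>x. norm (A x) \<le> KA * norm x"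
    using A.pos_bounded by (metis mult.commute)
  obtain KG where KG: "KG > 0" "\<And>x y. norm (\<Gamma> x y) \<le> KG * norm x * norm y"
    using G.pos_bounded by (metis mult.commute mult.assoc)
  \<comment> \<open>The solution will deviate from \<open>p + B v\<close> by at most \<open>d\<close>, as will \<open>p\<close> from \<open>\<psi>\<close> and the primitives of
    \<open>B v\<close> from 0; the total error is then at most \<open>3 d + 2 d \<tau>\<close>.\<close>
  define d where "d = \<epsilon> / (4 * (1 + \<tau>))"
  have d: "d > 0" using \<epsilon> \<tau> by (simp add: d_def)
  obtain p where p: "polynomial_function p" and p0: "p 0 = \<psi> 0"
    and p\<psi>: "\<And>t. t \<in> {0..\<tau>} \<Longrightarrow> norm (p t - \<psi> t) \<le> d"
  proof -
    obtain g where g: "polynomial_function g" "\<And>t. t \<in> {0..\<tau>} \<Longrightarrow> norm (\<psi> t - g t) < d / 2"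
      using Stone_Weierstrass_polynomial_function[OF compact_Icc \<psi>, of "d / 2"] d by auto
    show thesis
    proof (rule that[of "\<lambda>t. g t + (\<psi> 0 - g 0)"])
      fix t assume "t \<in> {0..\<tau>}"
      then have "norm (\<psi> t - g t) < d / 2" "norm (\<psi> 0 - g 0) < d / 2" using g(2) \<tau> by auto
      then show "norm (g t + (\<psi> 0 - g 0) - \<psi> t) \<le> d"
        using norm_triangle_ineq4[of "\<psi> 0 - g 0" "\<psi> t - g t"] by (simp add: algebra_simps)
    qed (simp_all add: g(1) polynomial_function_add)
  qed
  obtain p' where p': "polynomial_function p'" "\<And>t. (p has_vector_derivative p' t) (at t)"
    using has_vector_derivative_polynomial_function[OF p] by blast
  have "polynomial_function (\<lambda>t. p' t + A (p t) + \<Gamma> (p t) (p t))"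
    using polynomial_function_compose[OF p polynomial_function_bounded_linear[OF A]]
      polynomial_function_bounded_bilinear[OF \<Gamma> p p] p'(1)
    by (simp only: polynomial_function_add o_def)
  then obtain N a \<gamma> where a: "\<And>j. polynomial_function (a j :: real \<Rightarrow> real)"
    and \<eta>: "\<And>t. p' t + A (p t) + \<Gamma> (p t) (p t) = (\<Sum>j<(N::nat). (a j t)\<^sup>2 *\<^sub>R \<gamma> j)"
    by (rule polynomial_eq_sum_squares) blast
  define c where "c = pi / \<tau>"
  have c: "c \<noteq> 0" using \<tau> by (simp add: c_def)
  define b where "b j = B (\<Xi> (\<gamma> j))" for j
  define v where "v = oscillation c N a (\<lambda>j. \<Xi> (\<gamma> j))"
  define V where "V = oscillation c N a b"
  have BV: "B (v k t) = V k t" for k t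
    unfolding v_def V_def b_def using B.linear by (rule linear_oscillation)
  have "trig_polynomial (v k)" for k
    unfolding v_def by (rule oscillation_trig_polynomial) (rule a)
  from trig_polynomial_derivative[OF this]
  obtain v' where v': "\<And>k. trig_polynomial (v' k)" "\<And>k t. (v k has_vector_derivative v' k t) (at t)"
    by metis
  \<comment> \<open>The derivative of the oscillation is fed in through the control; it cancels against \<open>q'\<close> in the
    residual, so that no large term remains there.\<close>
  define u where "u k t = (\<Sum>j<N. (a j t)\<^sup>2 *\<^sub>R U (\<gamma> j)) + v' k t" for k t
  define q where "q k t = p t + V k t" for k t
  define q' where "q' k t = p' t + B (v' k t)" for k t
  have u: "trig_polynomial (u k)" for k
  proof -
    have "polynomial_function (\<lambda>t. (a j t)\<^sup>2)" for j
      using polynomial_function_mult[OF a a] by (simp add: power2_eq_square)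
    then have "polynomial_function (\<lambda>t. \<Sum>j<N. (a j t)\<^sup>2 *\<^sub>R U (\<gamma> j))"
      by (simp only: polynomial_function_sum polynomial_function_mult polynomial_function_const finite_lessThan)
    then show ?thesis
      unfolding u_def by (intro trig_polynomial.add v' trig_polynomial_polynomial)
  qed
  have cont_u: "continuous_on {0..\<tau>} (\<lambda>t. B (u k t))" for k
    by (intro B.continuous_on trig_polynomial_continuous_on u)
  have cont_q': "continuous_on {0..\<tau>} (q' k)" for k
    unfolding q'_def
    by (intro continuous_on_add B.continuous_on trig_polynomial_continuous_on v'
        continuous_on_polymonial_function p')
  have q': "(q k has_vector_derivative q' k t) (at t)" for k t
  proof -
    have "((\<lambda>t. B (v k t)) has_vector_derivative B (v' k t)) (at t)"
      using v'(2) by (rule B.has_vector_derivative)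
    then have "(V k has_vector_derivative B (v' k t)) (at t)" by (simp add: BV)
    then show ?thesis unfolding q_def q'_def by (intro has_vector_derivative_add p')
  qed
  have q_ends: "q k 0 = p 0" "q k \<tau> = p \<tau>" for k
  proof -
    have "sin (real k * (c * real (Suc j)) * \<tau>) = 0" for j
    proof -
      have "real k * (c * real (Suc j)) * \<tau> = real (k * Suc j) * pi"
        using \<tau> by (simp add: c_def algebra_simps)
      then show ?thesis by (simp only: sin_npi)
    qed
    then show "q k \<tau> = p \<tau>" by (simp add: q_def V_def oscillation_def)
    show "q k 0 = p 0" by (simp add: q_def V_def oscillation_def)
  qed
  define r where "r k s = B (u k s) - A (q k s) - \<Gamma> (q k s) (q k s) - q' k s" for k s
  have r: "weakly_null \<tau> r"
  proof -
    \<comment> \<open>\<open>L\<close> collects the terms linear in the oscillation and \<open>g\<close> is the error in replacing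
      \<open>f (V k s)\<close> by its mean; by the choice of \<open>a\<close> and \<open>\<gamma>\<close> nothing else is left.\<close>
    define L where "L s x = - (A x + 2 *\<^sub>R \<Gamma> (p s) x)" for s x
    have L: "polynomial_function (\<lambda>s. L s (b j))" "linear (L s)" for s j
    proof -
      show "polynomial_function (\<lambda>s. L s (b j))"
        using polynomial_function_bounded_bilinear[OF \<Gamma> p polynomial_function_const]
        by (simp only: L_def polynomial_function_minus polynomial_function_add
            polynomial_function_cmul polynomial_function_const)
      show "linear (L s)"
        unfolding L_def
        by (rule linearI) (simp_all add: A.add A.scaleR G.add_right G.scaleR_right algebra_simps)
    qed
    define g where "g k s = (\<Sum>j<N. (a j s)\<^sup>2 *\<^sub>R \<Gamma> (b j) (b j)) - \<Gamma> (V k s) (V k s)" for k s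
    have decomp: "r k s = L s (V k s) + g k s" for k s
    proof -
      have "(\<Sum>j<N. (a j s)\<^sup>2 *\<^sub>R \<gamma> j) =
          (\<Sum>j<N. (a j s)\<^sup>2 *\<^sub>R B (U (\<gamma> j))) - (\<Sum>j<N. (a j s)\<^sup>2 *\<^sub>R \<Gamma> (b j) (b j))"
        by (subst U\<Xi>) (simp add: f b_def scaleR_diff_right sum_subtractf)
      moreover have "B (u k s) = (\<Sum>j<N. (a j s)\<^sup>2 *\<^sub>R B (U (\<gamma> j))) + B (v' k s)"
        by (simp add: u_def B.add B.sum B.scaleR)
      ultimately have "B (u k s) = p' s + A (p s) + \<Gamma> (p s) (p s)
          + (\<Sum>j<N. (a j s)\<^sup>2 *\<^sub>R \<Gamma> (b j) (b j)) + B (v' k s)"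
        by (simp add: \<eta>)
      then show ?thesis
        by (simp add: r_def L_def g_def q_def q'_def A.add G.add_left G.add_right
            sym[of "V k s" "p s"] scaleR_2)
    qed
    have "weakly_null \<tau> (\<lambda>k s. L s (V k s) + g k s)"
    proof (rule weakly_null_add)
      show "weakly_null \<tau> (\<lambda>k s. L s (V k s))"
        unfolding V_def by (rule weakly_null_multiple_oscillation[OF a c L])
      show "weakly_null \<tau> g"
        unfolding g_def V_def by (rule weakly_null_bilinear_oscillation[OF \<Gamma> a c])
    qed
    then show ?thesis by (simp only: decomp[symmetric])
  qed
  obtain R where R: "\<And>k t. t \<in> {0..\<tau>} \<Longrightarrow> norm (q k t) \<le> R" "R \<ge> 0"
  proof -
    obtain R1 where R1: "\<And>k t. t \<in> {0..\<tau>} \<Longrightarrow> norm (V k t) \<le> R1"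
      unfolding V_def using oscillation_bounded[of a \<tau> c N b] a by blast
    obtain R2 where R2: "\<And>t. t \<in> {0..\<tau>} \<Longrightarrow> norm (p t) \<le> R2"
      using compact_imp_bounded[OF compact_continuous_image[OF continuous_on_polymonial_function[OF p] compact_Icc]]
      unfolding bounded_iff by blast
    have "norm (q k t) \<le> R2 + R1" if "t \<in> {0..\<tau>}" for k t
      unfolding q_def by (intro norm_triangle_mono R1 R2 that)
    then have "norm (q k t) \<le> max 0 (R2 + R1)" if "t \<in> {0..\<tau>}" for k t
      using that by (meson max.coboundedI2)
    then show thesis by (rule that) simp_all
  qed
  \<comment> \<open>\<open>R\<close>, hence \<open>M\<close> and \<open>\<delta>\<close>, are uniform in \<open>k\<close>, so the frequency can be chosen after them.\<close>
  define M where "M = KA + 2 * KG * R + 2 * KG"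
  have M: "M > 0" using KA(1) KG(1) R(2) by (simp add: M_def add_pos_nonneg)
  define \<delta> where "\<delta> = min 1 d / (2 * exp (2 * M * \<tau>))"
  have \<delta>: "\<delta> > 0" "2 * \<delta> * exp (2 * M * \<tau>) = min 1 d" using d by (auto simp: \<delta>_def)
  have "weakly_null \<tau> V"
    unfolding V_def
    by (rule weakly_null_multiple_oscillation[OF a c, where L = "\<lambda>_ x. x"])
      (simp_all add: linear_id[unfolded id_def])
  from eventually_happens[OF eventually_conj[OF weakly_null_eventually_small[OF r \<delta>(1)]
      weakly_null_eventually_small[OF this d]]]
  obtain k where k: "\<And>t. t \<in> {0..\<tau>} \<Longrightarrow> norm (integral {0..t} (r k)) < \<delta>"
    "\<And>t. t \<in> {0..\<tau>} \<Longrightarrow> norm (integral {0..t} (V k)) < d"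
    using trivial_limit_sequentially by blast
  obtain x where x: "continuous_on {0..\<tau>} x"
    and sol: "\<And>t. t \<in> {0..\<tau>} \<Longrightarrow>
      ((\<lambda>s. B (u k s) - A (x s) - \<Gamma> (x s) (x s)) has_integral x t - q k 0) {0..t}"
    and xq: "\<And>t. t \<in> {0..\<tau>} \<Longrightarrow> norm (x t - q k t) \<le> 2 * \<delta> * exp (2 * M * \<tau>)"
  proof (rule solution_near_approximate_solution[OF A \<Gamma> sym KA(2) KG(2) _ R(1) q' cont_q' cont_u])
    show "norm (integral {0..t} (\<lambda>s. B (u k s) - A (q k s) - \<Gamma> (q k s) (q k s) - q' k s)) \<le> \<delta>"
      if "t \<in> {0..\<tau>}" for t using k(1)[OF that] by (simp add: r_def[abs_def])
  qed (use M KG(1) \<delta> in \<open>auto simp: M_def\<close>)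
  have xq_d: "norm (x t - q k t) \<le> d" if "t \<in> {0..\<tau>}" for t
    using xq[OF that] \<delta>(2) by linarith
  have "norm (x \<tau> - \<psi> \<tau>) \<le> 2 * d"
    using xq_d[of \<tau>] p\<psi>[of \<tau>] \<tau> q_ends(2) norm_triangle_ineq[of "x \<tau> - p \<tau>" "p \<tau> - \<psi> \<tau>"] by simp
  moreover have "relax_norm \<tau> (\<lambda>t. x t - \<psi> t) \<le> 2 * d * \<tau> + d"
    unfolding relax_norm_def
  proof (rule cSUP_least)
    show "{0..\<tau>} \<noteq> {}" using \<tau> by simp
    fix t assume t: "t \<in> {0..\<tau>}"
    have V: "continuous_on {0..t} (V k)"
      unfolding V_def by (intro trig_polynomial_continuous_on oscillation_trig_polynomial a)
    have slow: "continuous_on {0..t} (\<lambda>s. x s - \<psi> s - V k s)"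
      using t by (intro continuous_on_diff V continuous_on_subset[OF x] continuous_on_subset[OF \<psi>]) auto
    have "norm (x s - \<psi> s - V k s) \<le> 2 * d" if "s \<in> {0..t}" for s
      using xq_d[of s] p\<psi>[of s] that t norm_triangle_ineq[of "x s - q k s" "p s - \<psi> s"]
      by (simp add: q_def algebra_simps)
    then have "norm (integral {0..t} (\<lambda>s. x s - \<psi> s - V k s)) \<le> 2 * d * (t - 0)"
      using t slow by (intro integral_bound) auto
    also have "\<dots> \<le> 2 * d * \<tau>" using t d by simp
    finally have "norm (integral {0..t} (\<lambda>s. x s - \<psi> s - V k s)) \<le> 2 * d * \<tau>" .
    moreover have "integral {0..t} (\<lambda>s. x s - \<psi> s) =
        integral {0..t} (\<lambda>s. x s - \<psi> s - V k s) + integral {0..t} (V k)"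
      using integral_add[OF integrable_continuous_real[OF slow] integrable_continuous_real[OF V]] by simp
    ultimately show "norm (integral {0..t} (\<lambda>s. x s - \<psi> s)) \<le> 2 * d * \<tau> + d"
      using k(2)[OF t] norm_triangle_ineq[of "integral {0..t} (\<lambda>s. x s - \<psi> s - V k s)" "integral {0..t} (V k)"]
      by simp
  qed
  moreover have "2 * d + (2 * d * \<tau> + d) < \<epsilon>"
  proof -
    have "4 * d * (1 + \<tau>) = \<epsilon>" using \<tau> by (simp add: d_def field_simps)
    moreover have "d * \<tau> > 0" using d \<tau> by simp
    ultimately show ?thesis using d by (simp add: algebra_simps)
  qed
  ultimately have "norm (x \<tau> - \<psi> \<tau>) + relax_norm \<tau> (\<lambda>t. x t - \<psi> t) < \<epsilon>" by linarith
  moreover have "is_solution A B f \<tau> (u k) (\<psi> 0) x"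
    using x sol by (simp add: is_solution_def f q_ends p0)
  moreover have "smooth_on {0..\<tau>} (u k)" using u by (rule trig_polynomial_smooth_on)
  ultimately show ?thesis by blast
qed

theorem proposition1p8:
  fixes A :: "'x::euclidean_space \<Rightarrow> 'x"
    and B :: "'u::euclidean_space \<Rightarrow> 'x"
    and \<Gamma> :: "'x \<Rightarrow> 'x \<Rightarrow> 'x"
    and f :: "'x \<Rightarrow> 'x"
    and \<tau> :: real
  assumes "linear A"
    and "linear B"
    and "bilinear \<Gamma>"
    and "\<And>x y. \<Gamma> x y = \<Gamma> y x"
    and "\<And>x. f x = \<Gamma> x x"
    and "\<And>\<gamma>. \<exists>u \<xi>. \<gamma> = B u - f (B \<xi>)"
    and "\<tau> > 0"
  shows "weakly_approx_tracking_controllable A B f \<tau> \<and>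
    (\<forall>\<psi> \<epsilon>. W12 \<tau> \<psi> \<longrightarrow> \<epsilon> > 0 \<longrightarrow>
       (\<exists>u x. smooth_on {0..\<tau>} u \<and> is_solution A B f \<tau> u (\<psi> 0) x \<and>
          norm (x \<tau> - \<psi> \<tau>) + relax_norm \<tau> (\<lambda>t. x t - \<psi> t) < \<epsilon>))"
proof -
  have tracking: "\<exists>u x. smooth_on {0..\<tau>} u \<and> is_solution A B f \<tau> u (\<psi> 0) x \<and>
      norm (x \<tau> - \<psi> \<tau>) + relax_norm \<tau> (\<lambda>t. x t - \<psi> t) < \<epsilon>"
    if "W12 \<tau> \<psi>" "\<epsilon> > 0" for \<psi> \<epsilon>
  proof (rule continuous_tracking)
    show "bounded_linear A" "bounded_linear B" "bounded_bilinear \<Gamma>"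
      using assms(1-3) by (simp_all add: linear_conv_bounded_linear bilinear_conv_bounded_bilinear)
    show "continuous_on {0..\<tau>} \<psi>" using that(1) by (simp add: W12_def)
  qed (fact assms that)+
  have "weakly_approx_tracking_controllable A B f \<tau>"
    unfolding weakly_approx_tracking_controllable_def
  proof (intro allI impI)
    fix \<psi> :: "real \<Rightarrow> 'x" and \<epsilon> :: real assume "W12 \<tau> \<psi>" "\<epsilon> > 0"
    then obtain u x where "smooth_on {0..\<tau>} u" "is_solution A B f \<tau> u (\<psi> 0) x"
      "norm (x \<tau> - \<psi> \<tau>) + relax_norm \<tau> (\<lambda>t. x t - \<psi> t) < \<epsilon>"
      using tracking by blast
    moreover from this(3) have "relax_norm \<tau> (\<lambda>t. x t - \<psi> t) \<le> \<epsilon>"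
      using norm_ge_zero[of "x \<tau> - \<psi> \<tau>"] by linarith
    ultimately show "\<exists>u x. L2_on \<tau> u \<and> is_solution A B f \<tau> u (\<psi> 0) x \<and>
        relax_norm \<tau> (\<lambda>t. x t - \<psi> t) \<le> \<epsilon>"
      using smooth_on_imp_L2_on by blast
  qed
  then show ?thesis using tracking by blast
qed

end
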